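(* For any $\alpha > 1 + 1/\sqrt{2}$ there exist constants $0 \le \tilde\nu_1 < \tilde\nu_2 \le 1$ and $d^* > 0$ such that for any constant $d \ge d^*$ the following holds. Let $Y,Y' \sim G(n,d/n)$ independently and let $k = \alpha \frac{\log d}{d} n$. Then with probability at least $1-\exp(-\Omega(n))$: (1) the family $\mathcal{F}(Y,Y')$, with domain $\mathcal{B}_n=\{0,1\}^n$, satisfies the overlap gap property with overlap $R(x_1,x_2)=\frac{1}{n} |\langle x_1,x_2\rangle|$ and parameters $\mu = k$, $\nu_1 = \tilde \nu_1 \frac{k}{n}$, $\nu_2 = \tilde \nu_2 \frac{k}{n}$; and (2) the functions $F(\cdot\,;Y)$ and $F(\cdot\,;Y')$ are $\nu_1$-separated above $\mu$ with respect to $R$. Here $\Omega(n)$ refers to $n\to\infty$ with $\alpha,d$ fixed (it may hide constants depending on $\alpha,d$).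
   Context: Let $m=\binom n2$; graphs on $[n]$ are identified with adjacency vectors in $\{0,1\}^m$, coordinates indexed in a fixed order. $G(n,d/n)$ is the Erdős–Rényi random graph. For $x\in\{0,1\}^n$ let $S(x)=\{i:x_i=1\}$ and $F(x;Y)=|S(x)|\cdot\mathbf{1}\{S(x) \text{ is an independent set of } Y\}$. For $Y,Y'\in\{0,1\}^m$, the path from $Y$ to $Y'$ is $Y=Z_0\to Z_1\to\cdots\to Z_m=Y'$ where $(Z_i)_j=Y_j$ for $j>i$ and $(Z_i)_j=Y'_j$ for $j\le i$. $\mathcal{F}(Y,Y')=\{F(\cdot\,;Z): Z \text{ on the path from } Y \text{ to } Y'\}$. A family $\mathcal{F}$ of real functions on a common domain $\mathcal{X}$ satisfies the overlap gap property for overlap $R:\mathcal{X}\times\mathcal{X}\to\mathbb{R}_{\ge0}$ with parameters $\mu\in\mathbb{R}$, $0\le\nu_1<\nu_2\le1$ if for all $f_1,f_2\in\mathcal{F}$ and $x_1,x_2\in\mathcal{X}$ with $f_1(x_1)\ge\mu$ and $f_2(x_2)\ge\mu$, one has $R(x_1,x_2)\in[0,\nu_1]\cup[\nu_2,1]$. Two functions $f,g$ on $\mathcal{X}$ are $\nu$-separated above $\mu$ with respect to $R$ if for all $x,y$ with $f(x)\ge\mu$ and $g(y)\ge\mu$, $R(x,y)\le\nu$. *)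

theory Defs
  imports "HOL-Probability.Probability"
begin

text \<open>
  A vector in \<open>{0,1}\<^sup>m\<close>, \<open>m = n choose 2\<close>, is a function \<open>Y :: nat \<Rightarrow> bool\<close> of which only the
  coordinates \<open>1, \<dots>, m\<close> matter.  The fixed order of the coordinates is a bijection \<open>e\<close> from
  \<open>{1..m}\<close> onto the two-element subsets of \<open>{1..n}\<close>; the edge \<open>e j\<close> is present iff \<open>Y j\<close>.
\<close>

definition edge_order :: "nat \<Rightarrow> (nat \<Rightarrow> nat set) \<Rightarrow> bool" where
  "edge_order n e \<longleftrightarrow> bij_betw e {1..n choose 2} {u. u \<subseteq> {1..n} \<and> card u = 2}"

definition edge_set :: "nat \<Rightarrow> (nat \<Rightarrow> nat set) \<Rightarrow> (nat \<Rightarrow> bool) \<Rightarrow> nat set set" where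
  "edge_set n e Y = {e j | j. j \<in> {1..n choose 2} \<and> Y j}"

definition independent_set :: "nat set set \<Rightarrow> nat set \<Rightarrow> bool" where
  "independent_set E S \<longleftrightarrow> (\<forall>u\<in>S. \<forall>v\<in>S. {u, v} \<notin> E)"

text \<open>
  The law of \<open>G(n, p)\<close>; \<open>bernoulli_pmf p\<close> has its usual meaning for \<open>0 \<le> p \<le> 1\<close> and
  truncates \<open>p\<close> to this range otherwise, so \<open>p = d / n\<close> is meaningful once \<open>n \<ge> d\<close>.
\<close>

definition erdos_renyi :: "nat \<Rightarrow> real \<Rightarrow> (nat \<Rightarrow> bool) pmf" where
  "erdos_renyi n p = Pi_pmf {1..n choose 2} False (\<lambda>_. bernoulli_pmf p)"

definition cube :: "nat \<Rightarrow> (nat \<Rightarrow> real) set" where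
  "cube n = {1..n} \<rightarrow>\<^sub>E {0, 1}"

definition supp :: "nat \<Rightarrow> (nat \<Rightarrow> real) \<Rightarrow> nat set" where
  "supp n x = {i \<in> {1..n}. x i = 1}"

definition objective :: "nat \<Rightarrow> (nat \<Rightarrow> nat set) \<Rightarrow> (nat \<Rightarrow> bool) \<Rightarrow> (nat \<Rightarrow> real) \<Rightarrow> real" where
  "objective n e Y x =
     real (card (supp n x)) * of_bool (independent_set (edge_set n e Y) (supp n x))"

definition path_point :: "(nat \<Rightarrow> bool) \<Rightarrow> (nat \<Rightarrow> bool) \<Rightarrow> nat \<Rightarrow> (nat \<Rightarrow> bool)" where
  "path_point Y Y' i = (\<lambda>j. if j \<le> i then Y' j else Y j)"

definition path_family ::
  "nat \<Rightarrow> (nat \<Rightarrow> nat set) \<Rightarrow> (nat \<Rightarrow> bool) \<Rightarrow> (nat \<Rightarrow> bool) \<Rightarrow> ((nat \<Rightarrow> real) \<Rightarrow> real) set" where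
  "path_family n e Y Y' = {objective n e (path_point Y Y' i) | i. i \<le> n choose 2}"

definition overlap :: "nat \<Rightarrow> (nat \<Rightarrow> real) \<Rightarrow> (nat \<Rightarrow> real) \<Rightarrow> real" where
  "overlap n x y = (1 / real n) * \<bar>\<Sum>i=1..n. x i * y i\<bar>"

text \<open>The admissibility of the parameters is part of the property.\<close>

definition overlap_gap_property ::
  "'a set \<Rightarrow> ('a \<Rightarrow> 'a \<Rightarrow> real) \<Rightarrow> ('a \<Rightarrow> real) set \<Rightarrow> real \<Rightarrow> real \<Rightarrow> real \<Rightarrow> bool" where
  "overlap_gap_property X R \<F> \<mu> \<nu>\<^sub>1 \<nu>\<^sub>2 \<longleftrightarrow>
     0 \<le> \<nu>\<^sub>1 \<and> \<nu>\<^sub>1 < \<nu>\<^sub>2 \<and> \<nu>\<^sub>2 \<le> 1 \<and>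
     (\<forall>f\<^sub>1\<in>\<F>. \<forall>f\<^sub>2\<in>\<F>. \<forall>x\<^sub>1\<in>X. \<forall>x\<^sub>2\<in>X.
        f\<^sub>1 x\<^sub>1 \<ge> \<mu> \<longrightarrow> f\<^sub>2 x\<^sub>2 \<ge> \<mu> \<longrightarrow> R x\<^sub>1 x\<^sub>2 \<in> {0..\<nu>\<^sub>1} \<union> {\<nu>\<^sub>2..1})"

definition separated_above ::
  "'a set \<Rightarrow> ('a \<Rightarrow> 'a \<Rightarrow> real) \<Rightarrow> real \<Rightarrow> real \<Rightarrow> ('a \<Rightarrow> real) \<Rightarrow> ('a \<Rightarrow> real) \<Rightarrow> bool" where
  "separated_above X R \<nu> \<mu> f g \<longleftrightarrow>
     (\<forall>x\<in>X. \<forall>y\<in>X. f x \<ge> \<mu> \<longrightarrow> g y \<ge> \<mu> \<longrightarrow> R x y \<le> \<nu>)"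

end

theory Submission
  imports Defs "HOL-Real_Asymp.Real_Asymp"
begin

text \<open>
  The proof is a first-moment argument.  Two independent sets of size at least \<open>k\<close> shrink to
  sets of size exactly \<open>K = \<lceil>k\<rceil>\<close> with the same overlap, as long as that overlap is at most
  \<open>K\<close>.  There are at most \<open>exp ((2 - t) k ln d + O(n / d))\<close> pairs of \<open>K\<close>-sets with overlap
  \<open>t k\<close>.  Along the path, the independence of such a pair requires the absence of at least
  \<open>2 (K choose 2) - (t k choose 2)\<close> edges, all decided by different independent coin flips,
  which has probability about \<open>exp (- (d / n) k\<^sup>2 (1 - t\<^sup>2 / 2))\<close>; for the two endpoints of the
  path the term \<open>t\<^sup>2 / 2\<close> is absent.  For \<open>k = \<alpha> n ln d / d\<close> the product is exponentially small
  as soon as \<open>2 - t < \<alpha> (1 - t\<^sup>2 / 2)\<close> and \<open>d\<close> is large, which holds for \<open>t\<close> near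
  \<open>2 - sqrt 2\<close>; the polynomially many positions on the path and overlaps cost nothing.
\<close>

section \<open>Coordinates of the edges inside a vertex set\<close>

text \<open>Edges are kept as coordinate indices, so that they can be compared with a position on
  the path and used as coordinates of the product measure.\<close>

definition edges_within :: "nat \<Rightarrow> (nat \<Rightarrow> nat set) \<Rightarrow> nat set \<Rightarrow> nat set" where
  "edges_within n e S = {j \<in> {1..n choose 2}. e j \<subseteq> S}"

lemma finite_edges_within [simp]: "finite (edges_within n e S)"
  by (simp add: edges_within_def)

lemma card_edges_within:
  assumes "edge_order n e" "S \<subseteq> {1..n}"
  shows "card (edges_within n e S) = card S choose 2"
proof -
  have bij: "bij_betw e {1..n choose 2} {u. u \<subseteq> {1..n} \<and> card u = 2}"
    using assms(1) by (simp add: edge_order_def)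
  have "e ` edges_within n e S = {u. u \<subseteq> S \<and> card u = 2}" (is "_ = ?U")
  proof (intro equalityI subsetI)
    fix u assume "u \<in> e ` edges_within n e S"
    then show "u \<in> ?U"
      using bij_betwE[OF bij] by (auto simp: edges_within_def)
  next
    fix u assume u: "u \<in> ?U"
    then have "u \<in> e ` {1..n choose 2}"
      using assms(2) bij_betw_imp_surj_on[OF bij] by auto
    then show "u \<in> e ` edges_within n e S"
      using u by (auto simp: edges_within_def)
  qed
  moreover have "inj_on e (edges_within n e S)"
    by (rule inj_on_subset[OF bij_betw_imp_inj_on[OF bij]]) (auto simp: edges_within_def)
  ultimately have "card (edges_within n e S) = card ?U"
    by (metis card_image)
  also have "\<dots> = card S choose 2"
    using assms(2) by (intro n_subsets) (auto intro: finite_subset)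
  finally show ?thesis .
qed

lemma edges_within_Int: "edges_within n e S \<inter> edges_within n e T = edges_within n e (S \<inter> T)"
  by (auto simp: edges_within_def)

lemma real_choose_two: "real (n choose 2) = real n * (real n - 1) / 2"
  by (induction n) (auto simp: numeral_2_eq_2 field_simps)

lemma no_edge_within:
  assumes "edge_order n e" "independent_set (edge_set n e Y) S" "j \<in> edges_within n e S"
  shows "\<not> Y j"
proof
  assume "Y j"
  have "e j \<in> {u. u \<subseteq> {1..n} \<and> card u = 2}"
    using bij_betwE[OF assms(1)[unfolded edge_order_def]] assms(3) by (auto simp: edges_within_def)
  then obtain u v where uv: "e j = {u, v}"
    by (auto simp: card_2_iff)
  then have "{u, v} \<in> edge_set n e Y"
    using \<open>Y j\<close> assms(3) by (auto simp: edge_set_def edges_within_def intro!: exI[of _ j])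
  moreover have "u \<in> S" "v \<in> S"
    using assms(3) uv by (auto simp: edges_within_def)
  ultimately show False
    using assms(2) by (auto simp: independent_set_def)
qed

lemma independent_set_subset:
  "independent_set E S \<Longrightarrow> T \<subseteq> S \<Longrightarrow> independent_set E T"
  by (auto simp: independent_set_def)

section \<open>Probabilities of absent edges and of independent pairs\<close>

lemma prob_erdos_renyi_no_edges:
  assumes "I \<subseteq> {1..n choose 2}" "0 \<le> p" "p \<le> 1"
  shows "measure_pmf.prob (erdos_renyi n p)
           (PiE_dflt {1..n choose 2} False (\<lambda>j. if j \<in> I then {False} else UNIV)) = (1 - p) ^ card I"
proof -
  have "measure_pmf.prob (erdos_renyi n p)
          (PiE_dflt {1..n choose 2} False (\<lambda>j. if j \<in> I then {False} else UNIV)) =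
        (\<Prod>j\<in>{1..n choose 2}. measure_pmf.prob (bernoulli_pmf p) (if j \<in> I then {False} else UNIV))"
    unfolding erdos_renyi_def by (rule measure_Pi_pmf_PiE_dflt) simp
  also have "\<dots> = (\<Prod>j\<in>{1..n choose 2}. if j \<in> I then 1 - p else 1)"
    using assms(2,3) by (intro prod.cong) (auto simp: measure_pmf_single)
  also have "\<dots> = (\<Prod>j\<in>I. 1 - p)"
    using assms(1) by (subst prod.inter_restrict[symmetric]) (auto simp: Int_absorb1)
  finally show ?thesis by simp
qed

text \<open>All coordinates of \<open>Y\<close> and \<open>Y'\<close> are independent flips, so the
  probability is at most a power of \<open>1 - p\<close>, and
  \<open>1 - p \<le> exp (- p)\<close>.\<close>

lemma prob_no_edges:
  assumes "I \<subseteq> {1..n choose 2}" "I' \<subseteq> {1..n choose 2}" "0 \<le> p" "p \<le> 1"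
  shows "measure_pmf.prob (pair_pmf (erdos_renyi n p) (erdos_renyi n p))
           {(Y, Y'). (\<forall>j\<in>I. \<not> Y j) \<and> (\<forall>j\<in>I'. \<not> Y' j)} \<le> exp (- p * real (card I + card I'))"
    (is "measure_pmf.prob ?P ?E \<le> _")
proof -
  define D where "D = (\<lambda>I. PiE_dflt {1..n choose 2} False (\<lambda>j. if j \<in> I then {False} else UNIV))"
  \<comment> \<open>Coordinates beyond \<open>n choose 2\<close> take the default
    \<open>False\<close> almost surely; on the support the event therefore lies in a product of two
    boxes.\<close>
  have supp: "set_pmf (erdos_renyi n p) \<subseteq> {Y. \<forall>j. j \<notin> {1..n choose 2} \<longrightarrow> Y j = False}"
    unfolding erdos_renyi_def by (rule set_Pi_pmf_subset) simp
  have "measure_pmf.prob ?P ?E = measure_pmf.prob ?P (?E \<inter> set_pmf ?P)"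
    by (rule measure_Int_set_pmf[symmetric])
  also have "\<dots> \<le> measure_pmf.prob ?P (D I \<times> D I')"
    using supp by (intro measure_pmf.finite_measure_mono) (auto simp: D_def PiE_dflt_def)
  also have "\<dots> = measure_pmf.prob (erdos_renyi n p) (D I) * measure_pmf.prob (erdos_renyi n p) (D I')"
    unfolding D_def by (intro measure_pmf_prob_product countable_finite finite_PiE_dflt) auto
  also have "\<dots> = (1 - p) ^ (card I + card I')"
    unfolding D_def power_add using assms by (intro arg_cong2[of _ _ _ _ "(*)"] prob_erdos_renyi_no_edges)
  also have "\<dots> \<le> exp (- p) ^ (card I + card I')"
    using assms exp_ge_add_one_self[of "- p"] by (intro power_mono) auto
  also have "\<dots> = exp (- p * real (card I + card I'))"
    by (simp add: exp_of_nat_mult[symmetric] mult.commute)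
  finally show ?thesis .
qed

text \<open>The edges of \<open>S\<close> are read from \<open>Y\<close> and those of
  \<open>T\<close> from \<open>Y'\<close>, so an edge inside both sets counts as two flips and no
  overlap term is lost.\<close>

lemma prob_independent_separate:
  assumes "edge_order n e" "S \<subseteq> {1..n}" "T \<subseteq> {1..n}" "card S = K" "card T = K"
    and "0 \<le> p" "p \<le> 1"
  shows "measure_pmf.prob (pair_pmf (erdos_renyi n p) (erdos_renyi n p))
           {(Y, Y'). independent_set (edge_set n e Y) S \<and> independent_set (edge_set n e Y') T}
         \<le> exp (- p * (real K * (real K - 1)))" (is "measure_pmf.prob ?P ?E \<le> _")
proof -
  let ?I = "edges_within n e S" and ?I' = "edges_within n e T"
  have "measure_pmf.prob ?P ?E \<le> measure_pmf.prob ?P {(Y, Y'). (\<forall>j\<in>?I. \<not> Y j) \<and> (\<forall>j\<in>?I'. \<not> Y' j)}"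
    using no_edge_within[OF assms(1)] by (intro measure_pmf.finite_measure_mono) auto
  also have "\<dots> \<le> exp (- p * real (card ?I + card ?I'))"
    by (rule prob_no_edges) (use assms in \<open>auto simp: edges_within_def\<close>)
  also have "real (card ?I + card ?I') = real K * (real K - 1)"
    using assms by (simp add: card_edges_within real_choose_two)
  finally show ?thesis .
qed

text \<open>Two points of the path may share flips, but only at edges inside
  \<open>S \<inter> T\<close>. Inclusion-exclusion leaves at least
  \<open>2 * (K choose 2) - (z choose 2)\<close> distinct flips.\<close>

lemma prob_independent_path:
  assumes "edge_order n e" "S \<subseteq> {1..n}" "T \<subseteq> {1..n}" "card S = K" "card T = K"
    and "card (S \<inter> T) = z" "0 \<le> p" "p \<le> 1"
  shows "measure_pmf.prob (pair_pmf (erdos_renyi n p) (erdos_renyi n p))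
           {(Y, Y'). independent_set (edge_set n e (path_point Y Y' a)) S \<and>
                     independent_set (edge_set n e (path_point Y Y' b)) T}
         \<le> exp (- p * (real K * (real K - 1) - real z * (real z - 1) / 2))"
    (is "measure_pmf.prob ?P ?E \<le> _")
proof -
  let ?A = "edges_within n e S" and ?B = "edges_within n e T"
  \<comment> \<open>\<open>I\<close> collects the coordinates read from \<open>Y\<close> and
    \<open>I'\<close> those read from \<open>Y'\<close>: the path point at position \<open>a\<close>
    takes coordinate \<open>j\<close> from \<open>Y'\<close> iff \<open>j \<le> a\<close>. Every
    edge inside \<open>S\<close> or \<open>T\<close> falls into at least one of the two.\<close>
  define I where "I = {j\<in>?A. a < j} \<union> {j\<in>?B. b < j}"
  define I' where "I' = {j\<in>?A. j \<le> a} \<union> {j\<in>?B. j \<le> b}"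
  have fin: "finite I" "finite I'"
    by (auto simp: I_def I'_def)
  have "card (?A \<union> ?B) \<le> card (I \<union> I')"
    using fin by (intro card_mono) (auto simp: I_def I'_def)
  then have "card (?A \<union> ?B) \<le> card I + card I'"
    using card_Un_le[of I I'] by linarith
  moreover have "card (?A \<union> ?B) + card (?A \<inter> ?B) = card ?A + card ?B"
    by (rule card_Un_Int[symmetric]) auto
  moreover have "card (?A \<inter> ?B) = z choose 2"
    using assms by (subst edges_within_Int, subst card_edges_within) auto
  ultimately have "real (card I + card I') + real (z choose 2) \<ge> real (card ?A) + real (card ?B)"
    by linarith
  then have card: "real (card I + card I') \<ge> real K * (real K - 1) - real z * (real z - 1) / 2"
    using assms by (simp add: card_edges_within real_choose_two)
  have "?E \<subseteq> {(Y, Y'). (\<forall>j\<in>I. \<not> Y j) \<and> (\<forall>j\<in>I'. \<not> Y' j)}"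
  proof (clarify, intro conjI ballI)
    fix Y Y' j
    assume indep: "independent_set (edge_set n e (path_point Y Y' a)) S"
      "independent_set (edge_set n e (path_point Y Y' b)) T"
    note no_edge = no_edge_within[OF assms(1) indep(1)] no_edge_within[OF assms(1) indep(2)]
    show "\<not> Y j" if "j \<in> I"
      using that no_edge[of j] by (auto simp: I_def path_point_def)
    show "\<not> Y' j" if "j \<in> I'"
      using that no_edge[of j] by (auto simp: I'_def path_point_def)
  qed
  then have "measure_pmf.prob ?P ?E \<le> measure_pmf.prob ?P {(Y, Y'). (\<forall>j\<in>I. \<not> Y j) \<and> (\<forall>j\<in>I'. \<not> Y' j)}"
    by (intro measure_pmf.finite_measure_mono) auto
  also have "\<dots> \<le> exp (- p * real (card I + card I'))"
    by (rule prob_no_edges) (use assms in \<open>auto simp: edges_within_def I_def I'_def\<close>)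
  also have "\<dots> \<le> exp (- p * (real K * (real K - 1) - real z * (real z - 1) / 2))"
    using mult_left_mono[OF card assms(7)] by simp
  finally show ?thesis .
qed

section \<open>Counting and shrinking pairs of sets\<close>

text \<open>A lower bound on the overlap lets one count serve both the exact overlaps on the path
  and all large overlaps at the endpoints.\<close>

definition set_pairs :: "nat \<Rightarrow> nat \<Rightarrow> nat \<Rightarrow> (nat set \<times> nat set) set" where
  "set_pairs n K z =
     {(S, T). S \<subseteq> {1..n} \<and> T \<subseteq> {1..n} \<and> card S = K \<and> card T = K \<and> z \<le> card (S \<inter> T)}"

lemma finite_set_pairs [simp]: "finite (set_pairs n K z)"
  by (rule finite_subset[of _ "Pow {1..n} \<times> Pow {1..n}"]) (auto simp: set_pairs_def)

text \<open>A pair is recovered from some common subset \<open>W\<close> of size \<open>z\<close>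
  and the two remainders \<open>S - W\<close> and \<open>T - W\<close>; counting a pair several
  times does no harm.\<close>

lemma card_set_pairs:
  "card (set_pairs n K z) \<le> (n choose z) * (n choose (K - z))\<^sup>2"
proof -
  define Q where "Q = (\<lambda>i. {U. U \<subseteq> {1..n} \<and> card U = i})"
  define h where "h = (\<lambda>(W :: nat set, U :: nat set, V). (W \<union> U, W \<union> V))"
  have fin: "finite (Q i)" for i
    by (simp add: Q_def)
  have cardQ: "card (Q i) = n choose i" for i
    unfolding Q_def by (subst n_subsets) auto
  have "set_pairs n K z \<subseteq> h ` (Q z \<times> Q (K - z) \<times> Q (K - z))"
  proof
    fix x assume "x \<in> set_pairs n K z"
    then obtain S T where x: "x = (S, T)" and ST: "S \<subseteq> {1..n}" "T \<subseteq> {1..n}" "card S = K"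
      "card T = K" "z \<le> card (S \<inter> T)"
      by (auto simp: set_pairs_def)
    then obtain W where W: "W \<subseteq> S \<inter> T" "card W = z" "finite W"
      by (meson obtain_subset_with_card_n)
    have "S - W \<in> Q (K - z)" "T - W \<in> Q (K - z)" "W \<in> Q z"
      using ST W by (auto simp: Q_def card_Diff_subset)
    moreover have "x = h (W, S - W, T - W)"
      using W by (auto simp: x h_def)
    ultimately show "x \<in> h ` (Q z \<times> Q (K - z) \<times> Q (K - z))"
      by blast
  qed
  then have "card (set_pairs n K z) \<le> card (Q z \<times> Q (K - z) \<times> Q (K - z))"
    using fin by (meson card_image_le card_mono finite_SigmaI finite_imageI le_trans)
  then show ?thesis
    by (simp add: card_cartesian_product cardQ power2_eq_square)
qed

text \<open>This bounds a single term of the expansion of \<open>(1 + 1 / d) ^ n\<close>. With the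
  weight \<open>1 / d\<close>, each chosen element costs \<open>ln d\<close>, and the error
  \<open>n / d\<close> is of lower order than the main terms, which are of order
  \<open>n * (ln d)\<^sup>2 / d\<close>.\<close>

lemma choose_le_power_exp:
  assumes "d > 0"
  shows "real (n choose j) \<le> d ^ j * exp (real n / d)"
proof (cases "j \<le> n")
  case True
  have "real (n choose j) * (1 / d) ^ j \<le> (\<Sum>i\<le>n. real (n choose i) * (1 / d) ^ i)"
    using True assms by (intro member_le_sum) auto
  also have "\<dots> = (1 / d + 1) ^ n"
    by (simp add: binomial_ring)
  also have "\<dots> \<le> exp (1 / d) ^ n"
    using assms exp_ge_add_one_self[of "1 / d"] by (intro power_mono) (auto simp: add.commute)
  also have "\<dots> = exp (real n / d)"
    by (simp add: exp_of_nat_mult[symmetric])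
  finally show ?thesis
    using assms by (simp add: field_simps power_divide)
qed (use assms in \<open>simp add: binomial_eq_0\<close>)

lemma union_bound:
  assumes "finite I" "\<And>i. i \<in> I \<Longrightarrow> measure_pmf.prob P (E i) \<le> B"
  shows "measure_pmf.prob P (\<Union>i\<in>I. E i) \<le> real (card I) * B"
proof -
  have "measure_pmf.prob P (\<Union>i\<in>I. E i) \<le> (\<Sum>i\<in>I. measure_pmf.prob P (E i))"
    using assms(1) by (intro measure_pmf.finite_measure_subadditive_finite) auto
  also have "\<dots> \<le> real (card I) * B"
    using sum_bounded_above[of I "\<lambda>i. measure_pmf.prob P (E i)" B] assms(2) by simp
  finally show ?thesis .
qed

lemma shrink_pair:
  assumes "finite S" "finite T" "K \<le> card S" "K \<le> card T"
  obtains S' T' where "S' \<subseteq> S" "T' \<subseteq> T" "card S' = K" "card T' = K"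
    "card (S' \<inter> T') = min K (card (S \<inter> T))"
proof -
  obtain W where W: "W \<subseteq> S \<inter> T" "card W = min K (card (S \<inter> T))" "finite W"
    by (meson min.cobounded2 obtain_subset_with_card_n)
  obtain S' where S': "W \<subseteq> S'" "S' \<subseteq> S" "card S' = K"
    using exists_subset_between[of W K S] W assms by auto
  obtain T' where T': "W \<subseteq> T'" "T' \<subseteq> T" "card T' = K"
    using exists_subset_between[of W K T] W assms by auto
  have fin: "finite S'" "finite T'"
    using S' T' assms finite_subset by blast+
  \<comment> \<open>Either \<open>W\<close> is the whole of \<open>S \<inter> T\<close>, or it
    already has \<open>K\<close> elements and equals both shrunken sets.\<close>
  have "S' \<inter> T' = W"
  proof (cases "card (S \<inter> T) \<le> K")
    case True
    then have "W = S \<inter> T"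
      using W assms by (intro card_subset_eq) auto
    then show ?thesis
      using S' T' by blast
  next
    case False
    then have "W = S'" "W = T'"
      using W S' T' fin by (intro card_subset_eq; simp)+
    then show ?thesis by simp
  qed
  then show thesis
    using that S' T' W by metis
qed

section \<open>The exponent of the first moment\<close>

text \<open>Here \<open>w\<close> is the loss from shared edges: \<open>z * (z - 1) / 2\<close> on
  the path, 0 at the endpoints. Half of the gap absorbs the error of the three binomial bounds.
  Rounding \<open>k\<close> to \<open>K\<close> costs \<open>2 * L\<close> and replacing
  \<open>k\<^sup>2\<close> by \<open>k * (k - 1)\<close> costs \<open>\<alpha> * L\<close>, both
  constant in \<open>n\<close>.\<close>

lemma first_moment_exponent:
  assumes d: "d > 1" and n: "n > 0" and "L = ln d"
    and k: "k = \<alpha> * (L / d) * real n" "k \<ge> 1" "k \<le> real K" "real K \<le> k + 1"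
    and z: "z \<le> K"
    and gap: "d / n * (k\<^sup>2 - w) - (2 * k - z) * L \<ge> \<delta> * n * L\<^sup>2 / d"
    and L: "\<delta> * L\<^sup>2 \<ge> 6"
  shows "real ((n choose z) * (n choose (K - z))\<^sup>2) * exp (- (d / n) * (K * (real K - 1) - w))
           \<le> exp ((2 + \<alpha>) * L - \<delta> * L\<^sup>2 / (2 * d) * n)"
proof -
  have Lpos: "L > 0"
    using d \<open>L = ln d\<close> by simp
  have "real ((n choose z) * (n choose (K - z))\<^sup>2) \<le>
        (d ^ z * exp (n / d)) * (d ^ (K - z) * exp (n / d))\<^sup>2"
    unfolding of_nat_mult of_nat_power using d
    by (intro mult_mono power_mono choose_le_power_exp) auto
  also have "\<dots> = d ^ (z + (K - z) + (K - z)) * (exp (n / d) * exp (n / d) * exp (n / d))"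
    by (simp add: power_add power2_eq_square algebra_simps)
  also have "\<dots> = exp ((2 * real K - z) * L + 3 * n / d)"
  proof -
    have "d ^ (z + (K - z) + (K - z)) = exp (L * (z + (K - z) + (K - z)))"
      using d \<open>L = ln d\<close> by (simp add: exp_of_nat2_mult del: of_nat_add)
    moreover have "real (z + (K - z) + (K - z)) = 2 * real K - z"
      using z by (simp add: of_nat_diff)
    ultimately show ?thesis
      by (simp add: exp_add[symmetric] algebra_simps)
  qed
  finally have count: "real ((n choose z) * (n choose (K - z))\<^sup>2) \<le> exp ((2 * real K - z) * L + 3 * n / d)" .
  have half: "\<delta> * n * L\<^sup>2 / d = \<delta> * L\<^sup>2 / (2 * d) * n + \<delta> * L\<^sup>2 / (2 * d) * n"
    using d by (simp add: field_simps)
  have "k * (k - 1) \<le> real K * (real K - 1)"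
    using k by (intro mult_mono) auto
  then have "d / n * (k * (k - 1) - w) \<le> d / n * (K * (real K - 1) - w)"
    using d by (intro mult_left_mono) auto
  \<comment> \<open>By the choice of \<open>k\<close>,
    \<open>d / n * k = \<alpha> * L\<close>.\<close>
  moreover have "d / n * (k * (k - 1) - w) = d / n * (k\<^sup>2 - w) - \<alpha> * L"
    using d n by (simp add: k(1) field_simps power2_eq_square)
  moreover have "(2 * real K - z) * L \<le> (2 * k + 2 - z) * L"
    using k Lpos by (intro mult_right_mono) auto
  moreover have "(2 * k + 2 - z) * L = (2 * k - z) * L + 2 * L"
    by (simp add: algebra_simps)
  \<comment> \<open>The constant 6 in the hypothesis on \<open>\<delta> * L\<^sup>2\<close> is
    chosen for this estimate.\<close>
  moreover have "3 * real n / d \<le> \<delta> * L\<^sup>2 / (2 * d) * n"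
  proof -
    have "3 * real n \<le> \<delta> * L\<^sup>2 / 2 * real n"
      using L by (intro mult_right_mono) auto
    then have "3 * real n / d \<le> \<delta> * L\<^sup>2 / 2 * n / d"
      using d by (intro divide_right_mono) auto
    then show ?thesis by simp
  qed
  ultimately have "(2 * real K - z) * L + 3 * n / d + - (d / n) * (K * (real K - 1) - w)
      \<le> (2 + \<alpha>) * L - \<delta> * L\<^sup>2 / (2 * d) * n"
    using gap unfolding half mult_minus_left distrib_right by linarith
  then have "exp ((2 * real K - z) * L + 3 * n / d) * exp (- (d / n) * (K * (real K - 1) - w))
      \<le> exp ((2 + \<alpha>) * L - \<delta> * L\<^sup>2 / (2 * d) * n)"
    by (simp add: exp_add[symmetric])
  moreover have "real ((n choose z) * (n choose (K - z))\<^sup>2) * exp (- (d / n) * (K * (real K - 1) - w))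
      \<le> exp ((2 * real K - z) * L + 3 * n / d) * exp (- (d / n) * (K * (real K - 1) - w))"
    using count by (intro mult_right_mono) auto
  ultimately show ?thesis by linarith
qed

text \<open>The polynomial counts pairs of path positions times overlaps, plus one event for the
  endpoints. Half of the exponential decay pays for it and for the constant
  \<open>C\<close>.\<close>

lemma eventually_poly_exp_le:
  assumes "\<eta> > 0"
  shows "\<forall>\<^sub>F n in sequentially.
    ((real (n choose 2) + 1)\<^sup>2 * (real n + 1) + 1) * exp (C - \<eta> * real n) \<le> exp (- (\<eta> / 2) * real n)"
  proof -
  have "\<forall>\<^sub>F n in sequentially.
    ((real n * (real n - 1) / 2 + 1) * (real n * (real n - 1) / 2 + 1) * (real n + 1) + 1) \<le> exp (\<eta> / 2 * real n - C)"
    using assms by real_asymp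
  then show ?thesis
  proof eventually_elim
    case (elim n)
    have "exp (\<eta> / 2 * real n - C) * exp (C - \<eta> * real n) = exp (- (\<eta> / 2) * real n)"
      by (simp add: exp_add[symmetric])
    then show ?case
      using mult_right_mono[OF elim, of "exp (C - \<eta> * real n)"]
      unfolding real_choose_two power2_eq_square by simp
  qed
qed

section \<open>The bad events and their probabilities\<close>

text \<open>The overlap is fixed exactly, because a larger overlap would allow more shared flips and
  weaken the probability bound.\<close>

definition path_event ::
  "nat \<Rightarrow> (nat \<Rightarrow> nat set) \<Rightarrow> nat \<Rightarrow> nat \<Rightarrow> nat \<Rightarrow> nat \<Rightarrow> ((nat \<Rightarrow> bool) \<times> (nat \<Rightarrow> bool)) set" where
  "path_event n e K z a b = {(Y, Y'). \<exists>(S, T)\<in>set_pairs n K z. card (S \<inter> T) = z \<and>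
     independent_set (edge_set n e (path_point Y Y' a)) S \<and>
     independent_set (edge_set n e (path_point Y Y' b)) T}"

text \<open>At the endpoints the probability bound does not depend on the overlap, so all overlaps
  from \<open>z\<close> on form a single event.\<close>

definition separate_event ::
  "nat \<Rightarrow> (nat \<Rightarrow> nat set) \<Rightarrow> nat \<Rightarrow> nat \<Rightarrow> ((nat \<Rightarrow> bool) \<times> (nat \<Rightarrow> bool)) set" where
  "separate_event n e K z = {(Y, Y'). \<exists>(S, T)\<in>set_pairs n K z.
     independent_set (edge_set n e Y) S \<and> independent_set (edge_set n e Y') T}"

lemma prob_path_event:
  assumes "edge_order n e" "0 \<le> p" "p \<le> 1"
  shows "measure_pmf.prob (pair_pmf (erdos_renyi n p) (erdos_renyi n p)) (path_event n e K z a b)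
    \<le> real ((n choose z) * (n choose (K - z))\<^sup>2) *
       exp (- p * (real K * (real K - 1) - real z * (real z - 1) / 2))" (is "measure_pmf.prob ?P _ \<le> _ * ?B")
proof -
  define Q where "Q = {(S, T) \<in> set_pairs n K z. card (S \<inter> T) = z}"
  have "Q \<subseteq> set_pairs n K z"
    by (auto simp: Q_def)
  then have Q: "finite Q" "card Q \<le> card (set_pairs n K z)"
    by (auto intro: card_mono finite_subset[OF _ finite_set_pairs])
  have "path_event n e K z a b = (\<Union>q\<in>Q. {(Y, Y').
      independent_set (edge_set n e (path_point Y Y' a)) (fst q) \<and>
      independent_set (edge_set n e (path_point Y Y' b)) (snd q)})"
    by (auto simp: path_event_def Q_def)
  also have "measure_pmf.prob ?P \<dots> \<le> real (card Q) * ?B"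
    by (intro union_bound Q prob_independent_path) (use assms in \<open>auto simp: Q_def set_pairs_def\<close>)
  also have "\<dots> \<le> real ((n choose z) * (n choose (K - z))\<^sup>2) * ?B"
    using order_trans[OF Q(2) card_set_pairs] by (intro mult_right_mono) (auto simp only: of_nat_le_iff exp_ge_zero)
  finally show ?thesis .
qed

lemma prob_separate_event:
  assumes "edge_order n e" "0 \<le> p" "p \<le> 1"
  shows "measure_pmf.prob (pair_pmf (erdos_renyi n p) (erdos_renyi n p)) (separate_event n e K z)
    \<le> real ((n choose z) * (n choose (K - z))\<^sup>2) * exp (- p * (real K * (real K - 1)))"
    (is "measure_pmf.prob ?P _ \<le> _ * ?B")
proof -
  have "separate_event n e K z = (\<Union>q\<in>set_pairs n K z. {(Y, Y').
      independent_set (edge_set n e Y) (fst q) \<and> independent_set (edge_set n e Y') (snd q)})"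
    by (auto simp: separate_event_def)
  also have "measure_pmf.prob ?P \<dots> \<le> real (card (set_pairs n K z)) * ?B"
    by (intro union_bound finite_set_pairs prob_independent_separate) (use assms in \<open>auto simp: set_pairs_def\<close>)
  also have "\<dots> \<le> real ((n choose z) * (n choose (K - z))\<^sup>2) * ?B"
    using card_set_pairs[of n K z] by (intro mult_right_mono) (auto simp only: of_nat_le_iff exp_ge_zero)
  finally show ?thesis .
qed

section \<open>From the absence of bad events to the two conclusions\<close>

lemma overlap_eq_card:
  assumes "x \<in> cube n" "y \<in> cube n"
  shows "overlap n x y = real (card (supp n x \<inter> supp n y)) / real n"
proof -
  have "(\<Sum>i=1..n. x i * y i) = (\<Sum>i\<in>{1..n}. if i \<in> supp n x \<inter> supp n y then 1 else 0)"
  proof (rule sum.cong)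
    fix i assume "i \<in> {1..n}"
    moreover from this have "x i \<in> {0, 1}" "y i \<in> {0, 1}"
      using assms PiE_mem unfolding cube_def by metis+
    ultimately show "x i * y i = (if i \<in> supp n x \<inter> supp n y then 1 else 0)"
      by (auto simp: supp_def)
  qed simp
  also have "\<dots> = real (card ({1..n} \<inter> (supp n x \<inter> supp n y)))"
    by (subst sum.inter_restrict[symmetric]) auto
  also have "{1..n} \<inter> (supp n x \<inter> supp n y) = supp n x \<inter> supp n y"
    by (auto simp: supp_def)
  finally show ?thesis
    by (simp add: overlap_def)
qed

text \<open>Positivity of \<open>k\<close> rules out the value 0 that the objective takes on sets
  that are not independent; cardinalities being integers, \<open>k\<close> may be rounded
  up.\<close>

lemma objective_geD:
  assumes "objective n e Y x \<ge> k" "k > 0"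
  shows "independent_set (edge_set n e Y) (supp n x)" "nat \<lceil>k\<rceil> \<le> card (supp n x)"
  using assms by (auto simp: objective_def of_bool_def nat_le_iff ceiling_le_iff split: if_splits)

lemma supp_subset: "supp n x \<subseteq> {1..n}"
  by (auto simp: supp_def)

lemma overlap_gap_of_no_path_event:
  assumes n: "n > 0" and k: "0 < k" "k \<le> real n"
    and \<nu>: "0 \<le> \<nu>\<^sub>1" "\<nu>\<^sub>1 < \<nu>\<^sub>2" "\<nu>\<^sub>2 \<le> 1"
    and no_path: "\<And>a b z. a \<le> n choose 2 \<Longrightarrow> b \<le> n choose 2 \<Longrightarrow> \<nu>\<^sub>1 * k < real z \<Longrightarrow> real z < \<nu>\<^sub>2 * k
           \<Longrightarrow> (Y, Y') \<notin> path_event n e (nat \<lceil>k\<rceil>) z a b"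
  shows "overlap_gap_property (cube n) (overlap n) (path_family n e Y Y')
           k (\<nu>\<^sub>1 * (k / real n)) (\<nu>\<^sub>2 * (k / real n))"
proof -
  have le1: "\<nu>\<^sub>2 * (k / real n) \<le> 1"
    using \<nu> k n mult_mono[of \<nu>\<^sub>2 1 "k / n" 1] by simp
  have lt: "\<nu>\<^sub>1 * (k / real n) < \<nu>\<^sub>2 * (k / real n)"
    using \<nu> k n by (intro mult_strict_right_mono) auto
  have gap: "overlap n x y \<in> {0..\<nu>\<^sub>1 * (k / real n)} \<union> {\<nu>\<^sub>2 * (k / real n)..1}"
    if a: "a \<le> n choose 2" and b: "b \<le> n choose 2" and x: "x \<in> cube n" and y: "y \<in> cube n"
      and f: "objective n e (path_point Y Y' a) x \<ge> k" and g: "objective n e (path_point Y Y' b) y \<ge> k"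
    for a b x y
  proof -
    define S where "S = supp n x"
    define T where "T = supp n y"
    define z where "z = card (S \<inter> T)"
    have ST: "S \<subseteq> {1..n}" "T \<subseteq> {1..n}" "finite S" "finite T"
      using supp_subset finite_subset unfolding S_def T_def by (metis finite_atLeastAtMost)+
    note fD = objective_geD[OF f k(1), folded S_def] and gD = objective_geD[OF g k(1), folded T_def]
    obtain S' T' where S'T': "S' \<subseteq> S" "T' \<subseteq> T" "card S' = nat \<lceil>k\<rceil>" "card T' = nat \<lceil>k\<rceil>"
      "card (S' \<inter> T') = min (nat \<lceil>k\<rceil>) z"
      using shrink_pair[OF ST(3,4) fD(2) gD(2)] unfolding z_def by metis
    have "\<not> (\<nu>\<^sub>1 * k < real z \<and> real z < \<nu>\<^sub>2 * k)"
    proof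
      assume z: "\<nu>\<^sub>1 * k < real z \<and> real z < \<nu>\<^sub>2 * k"
      \<comment> \<open>Since \<open>\<nu>\<^sub>2 \<le> 1\<close>, the overlap is below the target
        size, so shrinking preserves it exactly.\<close>
      have "real z < k"
        using z k mult_right_mono[OF \<nu>(3), of k] by linarith
      then have "z \<le> nat \<lceil>k\<rceil>"
        by linarith
      then have "(Y, Y') \<in> path_event n e (nat \<lceil>k\<rceil>) z a b"
        using S'T' ST independent_set_subset[OF fD(1) S'T'(1)] independent_set_subset[OF gD(1) S'T'(2)]
        unfolding path_event_def mem_Collect_eq prod.case
        by (intro bexI[of _ "(S', T')"]) (auto simp: set_pairs_def)
      then show False
        using no_path[OF a b] z by blast
    qed
    moreover have "z \<le> n"
      using card_mono[of "{1..n}" "S \<inter> T"] ST unfolding z_def by auto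
    ultimately show ?thesis
      using n by (auto simp: overlap_eq_card[OF x y] S_def T_def z_def field_simps not_less)
  qed
  show ?thesis
    unfolding overlap_gap_property_def
  proof (intro conjI ballI impI le1 lt)
    fix f g x y
    assume "f \<in> path_family n e Y Y'" "g \<in> path_family n e Y Y'" "x \<in> cube n" "y \<in> cube n"
      "k \<le> f x" "k \<le> g y"
    moreover from this obtain a b where "a \<le> n choose 2" "f = objective n e (path_point Y Y' a)"
      "b \<le> n choose 2" "g = objective n e (path_point Y Y' b)"
      unfolding path_family_def by blast
    ultimately show "overlap n x y \<in> {0..\<nu>\<^sub>1 * (k / real n)} \<union> {\<nu>\<^sub>2 * (k / real n)..1}"
      using gap by blast
  qed (use \<nu> k in auto)
qed

lemma separated_of_no_separate_event:
  assumes n: "n > 0" and k: "0 < k" and \<nu>: "\<nu> \<le> 1"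
    and no_sep: "(Y, Y') \<notin> separate_event n e (nat \<lceil>k\<rceil>) (nat \<lceil>\<nu> * k\<rceil>)"
  shows "separated_above (cube n) (overlap n) (\<nu> * (k / real n)) k (objective n e Y) (objective n e Y')"
  unfolding separated_above_def
proof (intro ballI impI)
  fix x y
  assume x: "x \<in> cube n" and y: "y \<in> cube n"
    and f: "k \<le> objective n e Y x" and g: "k \<le> objective n e Y' y"
  define S where "S = supp n x"
  define T where "T = supp n y"
  have ST: "S \<subseteq> {1..n}" "T \<subseteq> {1..n}" "finite S" "finite T"
    using supp_subset finite_subset unfolding S_def T_def by (metis finite_atLeastAtMost)+
  note fD = objective_geD[OF f k, folded S_def] and gD = objective_geD[OF g k, folded T_def]
  obtain S' T' where S'T': "S' \<subseteq> S" "T' \<subseteq> T" "card S' = nat \<lceil>k\<rceil>" "card T' = nat \<lceil>k\<rceil>"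
    "card (S' \<inter> T') = min (nat \<lceil>k\<rceil>) (card (S \<inter> T))"
    using shrink_pair[OF ST(3,4) fD(2) gD(2)] by metis
  have "\<not> nat \<lceil>\<nu> * k\<rceil> \<le> card (S \<inter> T)"
  proof
    assume "nat \<lceil>\<nu> * k\<rceil> \<le> card (S \<inter> T)"
    \<comment> \<open>Shrinking may reduce the overlap to the target size, but that is still at
      least the threshold.\<close>
    moreover have "nat \<lceil>\<nu> * k\<rceil> \<le> nat \<lceil>k\<rceil>"
      using \<nu> k mult_right_mono[of \<nu> 1 k] by (intro nat_mono ceiling_mono) simp
    ultimately have "(Y, Y') \<in> separate_event n e (nat \<lceil>k\<rceil>) (nat \<lceil>\<nu> * k\<rceil>)"
      using S'T' ST independent_set_subset[OF fD(1) S'T'(1)] independent_set_subset[OF gD(1) S'T'(2)]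
      unfolding separate_event_def mem_Collect_eq prod.case
      by (intro bexI[of _ "(S', T')"]) (auto simp: set_pairs_def)
    then show False
      using no_sep by blast
  qed
  then have "real (card (S \<inter> T)) \<le> \<nu> * k"
    by (simp add: nat_le_iff ceiling_le_iff not_le)
  then show "overlap n x y \<le> \<nu> * (k / real n)"
    using n by (simp add: overlap_eq_card[OF x y] S_def T_def divide_right_mono)
qed

section \<open>The exponent as a function of the relative overlap\<close>

text \<open>
  After division by \<open>n * (ln d)\<^sup>2 / d\<close>, the exponent of the expected number of pairs with overlap
  \<open>t * k\<close> is the negative of this expression.  The ratio \<open>(2 - t) / (1 - t\<^sup>2 / 2)\<close> has
  the minimum \<open>1 + 1 / sqrt 2\<close>, attained at \<open>t = 2 - sqrt 2\<close>.
\<close>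

lemma exponent_gap:
  fixes \<alpha> :: real
  assumes "\<alpha> > 1 + 1 / sqrt 2"
  obtains \<nu>\<^sub>1 \<nu>\<^sub>2 \<delta> where "0 < \<nu>\<^sub>1" "\<nu>\<^sub>1 < \<nu>\<^sub>2" "\<nu>\<^sub>2 \<le> 1" "\<delta> > 0"
    "\<And>t. \<nu>\<^sub>1 \<le> t \<Longrightarrow> t \<le> \<nu>\<^sub>2 \<Longrightarrow> \<delta> \<le> \<alpha>\<^sup>2 * (1 - t\<^sup>2 / 2) - \<alpha> * (2 - t)"
proof -
  define q where "q = (\<lambda>t. \<alpha>\<^sup>2 * (1 - t\<^sup>2 / 2) - \<alpha> * (2 - t))"
  define s where "s = 2 - sqrt 2"
  have sqrt2: "1 < sqrt 2" "sqrt 2 < 2" "sqrt 2 * sqrt 2 = 2"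
    by (auto intro: real_less_lsqrt)
  have "1 / sqrt 2 = sqrt 2 / 2"
    using sqrt2 by (simp add: field_simps)
  then have \<alpha>: "\<alpha> > 1 + sqrt 2 / 2"
    using assms by simp
  have "s\<^sup>2 = 6 - 4 * sqrt 2"
    using sqrt2(3) by (simp add: s_def power2_eq_square algebra_simps)
  then have "q s = \<alpha>\<^sup>2 * (2 * sqrt 2 - 2) - \<alpha> * sqrt 2"
    by (simp add: q_def s_def diff_divide_distrib)
  \<comment> \<open>The last factor is positive exactly when \<open>\<alpha>\<close> exceeds the
    threshold, as \<open>1 / sqrt 2 = sqrt 2 / 2\<close>.\<close>
  also have "\<alpha>\<^sup>2 * (2 * sqrt 2 - 2) - \<alpha> * sqrt 2 = \<alpha> * (2 * (sqrt 2 - 1)) * (\<alpha> - (1 + sqrt 2 / 2))"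
    using sqrt2(3) by (simp add: power2_eq_square algebra_simps)
  also have "\<dots> > 0"
    using \<alpha> sqrt2(1) by (intro mult_pos_pos) linarith+
  finally have pos: "q s > 0" .
  have "isCont q s"
    unfolding q_def by (intro continuous_intros) auto
  then obtain \<epsilon> where \<epsilon>: "\<epsilon> > 0" "\<And>t. \<bar>t - s\<bar> < \<epsilon> \<Longrightarrow> \<bar>q t - q s\<bar> < q s / 2"
    using pos unfolding continuous_at_real_range by (metis half_gt_zero real_norm_def)
  \<comment> \<open>The forbidden interval starts at \<open>s\<close> and extends as far as
    continuity keeps \<open>q\<close> above half of \<open>q s\<close>. It is cut at 1 for
    \<open>\<nu>\<^sub>2 \<le> 1\<close>, and \<open>s < 1\<close> keeps it nondegenerate.\<close>
  define r where "r = min (s + \<epsilon> / 2) 1"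
  show thesis
  proof (rule that[of s r "q s / 2"])
    fix t assume "s \<le> t" "t \<le> r"
    then have "\<bar>q t - q s\<bar> < q s / 2"
      using \<epsilon> by (intro \<epsilon>(2)) (auto simp: r_def)
    then have "q s / 2 \<le> q t"
      by linarith
    then show "q s / 2 \<le> \<alpha>\<^sup>2 * (1 - t\<^sup>2 / 2) - \<alpha> * (2 - t)"
      by (simp only: q_def)
  qed (use pos \<epsilon> sqrt2 in \<open>auto simp: s_def r_def\<close>)
qed

section \<open>Assembling the bounds\<close>

lemma prob_overlap_gap_ge:
  fixes \<alpha> d :: real
  defines "L \<equiv> ln d"
  assumes e: "edge_order n e" and \<alpha>: "\<alpha> > 0" and \<nu>: "0 < \<nu>\<^sub>1" "\<nu>\<^sub>1 < \<nu>\<^sub>2" "\<nu>\<^sub>2 \<le> 1"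
    and gap: "\<And>t. \<nu>\<^sub>1 \<le> t \<Longrightarrow> t \<le> \<nu>\<^sub>2 \<Longrightarrow> \<delta> \<le> \<alpha>\<^sup>2 * (1 - t\<^sup>2 / 2) - \<alpha> * (2 - t)"
    and d: "d > 1" "\<delta> * L\<^sup>2 \<ge> 6" "\<alpha> * (L / d) \<le> 1"
    and n: "d \<le> real n" and k: "k = \<alpha> * (L / d) * real n" "k \<ge> 1"
  shows "measure_pmf.prob (pair_pmf (erdos_renyi n (d / real n)) (erdos_renyi n (d / real n)))
      {(Y, Y'). overlap_gap_property (cube n) (overlap n) (path_family n e Y Y')
                  k (\<nu>\<^sub>1 * (k / real n)) (\<nu>\<^sub>2 * (k / real n)) \<and>
                separated_above (cube n) (overlap n) (\<nu>\<^sub>1 * (k / real n)) k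
                  (objective n e Y) (objective n e Y')}
    \<ge> 1 - ((real (n choose 2) + 1)\<^sup>2 * (real n + 1) + 1) *
            exp ((2 + \<alpha>) * L - \<delta> * L\<^sup>2 / (2 * d) * real n)"
    (is "measure_pmf.prob ?P ?good \<ge> 1 - _ * ?B")
proof -
  define K where "K = nat \<lceil>k\<rceil>"
  define z\<^sub>0 where "z\<^sub>0 = nat \<lceil>\<nu>\<^sub>1 * k\<rceil>"
  \<comment> \<open>The cap \<open>z \<le> n\<close> gives the count \<open>n + 1\<close>; overlaps
    below \<open>\<nu>\<^sub>2 * k\<close> satisfy it because \<open>k \<le> n\<close>.\<close>
  define Z where "Z = {z. z \<le> n \<and> \<nu>\<^sub>1 * k < real z \<and> real z < \<nu>\<^sub>2 * k}"
  have n0: "n > 0" and p: "0 \<le> d / n" "d / n \<le> 1"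
    using n d by auto
  have kn: "k \<le> real n"
    unfolding k(1) using mult_right_mono[OF d(3), of "real n"] by simp
  have K: "k \<le> real K" "real K \<le> k + 1"
    unfolding K_def using k by linarith+
  \<comment> \<open>The switch \<open>c\<close> is 1 for the path and 0 for the endpoints.\<close>
  have scale: "d / n * (k\<^sup>2 - (t * k)\<^sup>2 * c / 2) - (2 * k - t * k) * L
      = (n * L\<^sup>2 / d) * (\<alpha>\<^sup>2 * (1 - t\<^sup>2 * c / 2) - \<alpha> * (2 - t))" for t c
    using n0 d by (simp add: k(1) power2_eq_square field_simps)
  have factor: "0 \<le> n * L\<^sup>2 / d"
    using d by simp
  have path: "measure_pmf.prob ?P (path_event n e K z a b) \<le> ?B" if z: "z \<in> Z" for z a b
  proof -
    have zK: "z \<le> K"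
    proof -
      have "real z \<le> real K"
        using z K k(2) mult_right_mono[OF \<nu>(3), of k] unfolding Z_def mem_Collect_eq by linarith
      then show ?thesis by simp
    qed
    define t where "t = real z / k"
    have t: "\<nu>\<^sub>1 \<le> t" "t \<le> \<nu>\<^sub>2" "real z = t * k"
      using z k(2) by (auto simp: Z_def t_def pos_le_divide_eq pos_divide_le_eq)
    have "\<delta> * n * L\<^sup>2 / d \<le> d / n * (k\<^sup>2 - (t * k)\<^sup>2 / 2) - (2 * k - t * k) * L"
      using mult_left_mono[OF gap[OF t(1,2)] factor] scale[of t 1] by (simp add: algebra_simps)
    \<comment> \<open>Passing from \<open>z\<^sup>2 / 2\<close> to \<open>z * (z - 1) / 2\<close>
      makes the loss smaller.\<close>
    also have "\<dots> \<le> d / n * (k\<^sup>2 - real z * (real z - 1) / 2) - (2 * k - real z) * L"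
      unfolding t(3)[symmetric] using d
      by (intro diff_right_mono mult_left_mono) (auto simp: power2_eq_square algebra_simps)
    finally have "real ((n choose z) * (n choose (K - z))\<^sup>2) *
        exp (- (d / n) * (K * (real K - 1) - real z * (real z - 1) / 2)) \<le> ?B"
      by (intro first_moment_exponent[OF d(1) n0 _ k K zK _ d(2)]) (simp_all add: L_def)
    then show ?thesis
      using prob_path_event[OF e p] by (rule order_trans[rotated])
  qed
  have sep: "measure_pmf.prob ?P (separate_event n e K z\<^sub>0) \<le> ?B"
  proof -
    have zK: "z\<^sub>0 \<le> K"
      unfolding z\<^sub>0_def K_def using \<nu> k mult_right_mono[of \<nu>\<^sub>1 1 k]
      by (intro nat_mono ceiling_mono) simp
    have z\<^sub>0: "\<nu>\<^sub>1 * k \<le> real z\<^sub>0"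
      unfolding z\<^sub>0_def by (rule real_nat_ceiling_ge)
    have "\<delta> \<le> \<alpha>\<^sup>2 * (1 - \<nu>\<^sub>1\<^sup>2 / 2) - \<alpha> * (2 - \<nu>\<^sub>1)"
      using gap \<nu> by simp
    \<comment> \<open>Dropping the overlap loss only enlarges the gap, so its value at
      \<open>\<nu>\<^sub>1\<close> covers the endpoints.\<close>
    also have "\<dots> \<le> \<alpha>\<^sup>2 * (1 - \<nu>\<^sub>1\<^sup>2 * 0 / 2) - \<alpha> * (2 - \<nu>\<^sub>1)"
      by (intro diff_right_mono mult_left_mono) auto
    finally have "n * L\<^sup>2 / d * \<delta> \<le> d / n * (k\<^sup>2 - (\<nu>\<^sub>1 * k)\<^sup>2 * 0 / 2) - (2 * k - \<nu>\<^sub>1 * k) * L"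
      unfolding scale using factor by (intro mult_left_mono)
    \<comment> \<open>Rounding the overlap up to \<open>z\<^sub>0\<close> lowers the counting
      exponent.\<close>
    also have "\<dots> \<le> d / n * (k\<^sup>2 - 0) - (2 * k - real z\<^sub>0) * L"
      using z\<^sub>0 d by (simp add: L_def mult_right_mono)
    finally have "real ((n choose z\<^sub>0) * (n choose (K - z\<^sub>0))\<^sup>2) *
        exp (- (d / n) * (K * (real K - 1) - 0)) \<le> ?B"
      by (intro first_moment_exponent[OF d(1) n0 _ k K zK _ d(2)]) (simp_all add: L_def mult_ac)
    then show ?thesis
      using prob_separate_event[OF e p, of K z\<^sub>0] by simp
  qed
  define I where "I = {..n choose 2} \<times> {..n choose 2} \<times> Z"
  define bad where "bad = (\<Union>(a, b, z)\<in>I. path_event n e K z a b)"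
  have finZ: "finite Z" "card Z \<le> n + 1"
    using card_mono[of "{..n}" Z] by (auto simp: Z_def)
  have "measure_pmf.prob ?P bad \<le> real (card I) * ?B"
    unfolding bad_def I_def using finZ
    by (intro union_bound) (simp, clarify, rule path)
  also have "\<dots> \<le> ((real (n choose 2) + 1)\<^sup>2 * (real n + 1)) * ?B"
  proof (intro mult_right_mono)
    have "real (card I) = (real (n choose 2) + 1)\<^sup>2 * real (card Z)"
      by (simp add: I_def card_cartesian_product power2_eq_square algebra_simps)
    also have "\<dots> \<le> (real (n choose 2) + 1)\<^sup>2 * (real n + 1)"
      using finZ by (intro mult_left_mono) auto
    finally show "real (card I) \<le> (real (n choose 2) + 1)\<^sup>2 * (real n + 1)" .
  qed simp
  finally have bad: "measure_pmf.prob ?P bad \<le> (real (n choose 2) + 1)\<^sup>2 * (real n + 1) * ?B" .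
  have "- ?good \<subseteq> bad \<union> separate_event n e K z\<^sub>0"
  proof (rule ccontr)
    assume "\<not> - ?good \<subseteq> bad \<union> separate_event n e K z\<^sub>0"
    then obtain Y Y' where Y: "(Y, Y') \<notin> ?good" "(Y, Y') \<notin> bad" "(Y, Y') \<notin> separate_event n e K z\<^sub>0"
      by auto
    have "(Y, Y') \<notin> path_event n e (nat \<lceil>k\<rceil>) z a b"
      if "a \<le> n choose 2" "b \<le> n choose 2" "\<nu>\<^sub>1 * k < real z" "real z < \<nu>\<^sub>2 * k" for a b z
    proof -
      have "real z \<le> real n"
        using that kn k(2) mult_right_mono[OF \<nu>(3), of k] by linarith
      then have "(a, b, z) \<in> I"
        using that by (simp add: I_def Z_def)
      then show ?thesis
        using Y(2) unfolding bad_def K_def by blast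
    qed
    then have "(Y, Y') \<in> ?good"
      using Y(3) \<nu> k(2) kn n0 unfolding K_def z\<^sub>0_def mem_Collect_eq prod.case
      by (intro conjI overlap_gap_of_no_path_event separated_of_no_separate_event) simp_all
    then show False
      using Y(1) by blast
  qed
  then have "measure_pmf.prob ?P (- ?good) \<le> measure_pmf.prob ?P (bad \<union> separate_event n e K z\<^sub>0)"
    by (intro measure_pmf.finite_measure_mono) auto
  also have "\<dots> \<le> measure_pmf.prob ?P bad + measure_pmf.prob ?P (separate_event n e K z\<^sub>0)"
    by (intro measure_Un_le) auto
  also have "\<dots> \<le> ((real (n choose 2) + 1)\<^sup>2 * (real n + 1) + 1) * ?B"
    using bad sep by (simp add: distrib_right)
  finally show ?thesis
    using measure_pmf.prob_compl[of ?good ?P] by (simp add: Compl_eq_Diff_UNIV)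
qed

theorem theorem2p13:
  fixes e :: "nat \<Rightarrow> nat \<Rightarrow> nat set" and \<alpha> :: real
  assumes "\<And>n. edge_order n (e n)"
    and "\<alpha> > 1 + 1 / sqrt 2"
  shows "\<exists>\<nu>\<^sub>1 \<nu>\<^sub>2 d\<^sub>0 :: real. 0 \<le> \<nu>\<^sub>1 \<and> \<nu>\<^sub>1 < \<nu>\<^sub>2 \<and> \<nu>\<^sub>2 \<le> 1 \<and> d\<^sub>0 > 0 \<and>
    (\<forall>d\<ge>d\<^sub>0. \<exists>c>0. \<forall>\<^sub>F n in sequentially.
      (let k = \<alpha> * (ln d / d) * real n in
        measure_pmf.prob
          (pair_pmf (erdos_renyi n (d / real n)) (erdos_renyi n (d / real n)))
          {(Y, Y').
             overlap_gap_property (cube n) (overlap n) (path_family n (e n) Y Y')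
               k (\<nu>\<^sub>1 * (k / real n)) (\<nu>\<^sub>2 * (k / real n)) \<and>
             separated_above (cube n) (overlap n) (\<nu>\<^sub>1 * (k / real n)) k
               (objective n (e n) Y) (objective n (e n) Y')}
        \<ge> 1 - exp (- c * real n)))"
proof -
  have \<alpha>: "\<alpha> > 0"
    using assms(2) by (smt (verit) divide_nonneg_nonneg real_sqrt_ge_zero)
  \<comment> \<open>These constants depend on \<open>\<alpha>\<close> alone, so they can be fixed
    before \<open>d\<close>.\<close>
  obtain \<nu>\<^sub>1 \<nu>\<^sub>2 \<delta> where \<nu>: "0 < \<nu>\<^sub>1" "\<nu>\<^sub>1 < \<nu>\<^sub>2" "\<nu>\<^sub>2 \<le> 1" and \<delta>: "\<delta> > 0"
    and gap: "\<And>t. \<nu>\<^sub>1 \<le> t \<Longrightarrow> t \<le> \<nu>\<^sub>2 \<Longrightarrow> \<delta> \<le> \<alpha>\<^sup>2 * (1 - t\<^sup>2 / 2) - \<alpha> * (2 - t)"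
    using exponent_gap[OF assms(2)] by metis
  \<comment> \<open>The three demands make \<open>ln d\<close> positive, let the gap absorb the
    binomial errors, and ensure \<open>k \<le> n\<close>.\<close>
  have "\<forall>\<^sub>F d in at_top. d > 1 \<and> \<delta> * (ln d)\<^sup>2 \<ge> 6 \<and> \<alpha> * (ln d / d) \<le> (1 :: real)"
    using \<delta> \<alpha> by (intro eventually_conj) real_asymp+
  then obtain d\<^sub>0 where d\<^sub>0: "\<And>d. d \<ge> d\<^sub>0 \<Longrightarrow> d > 1 \<and> \<delta> * (ln d)\<^sup>2 \<ge> 6 \<and> \<alpha> * (ln d / d) \<le> 1"
    unfolding eventually_at_top_linorder by blast
  have "\<exists>c>0. \<forall>\<^sub>F n in sequentially.
      (let k = \<alpha> * (ln d / d) * real n in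
        measure_pmf.prob
          (pair_pmf (erdos_renyi n (d / real n)) (erdos_renyi n (d / real n)))
          {(Y, Y').
             overlap_gap_property (cube n) (overlap n) (path_family n (e n) Y Y')
               k (\<nu>\<^sub>1 * (k / real n)) (\<nu>\<^sub>2 * (k / real n)) \<and>
             separated_above (cube n) (overlap n) (\<nu>\<^sub>1 * (k / real n)) k
               (objective n (e n) Y) (objective n (e n) Y')}
        \<ge> 1 - exp (- c * real n))" if "d \<ge> d\<^sub>0" for d
  proof -
    note d = d\<^sub>0[OF that]
    define \<eta> where "\<eta> = \<delta> * (ln d)\<^sup>2 / (2 * d)"
    have \<eta>: "\<eta> > 0"
      using d \<delta> by (auto simp: \<eta>_def)
    have rate: "\<alpha> * (ln d / d) > 0"
      using d \<alpha> by simp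
    \<comment> \<open>For \<open>n \<ge> d\<close> the quotient \<open>d / n\<close> is a
      probability; \<open>k \<ge> 1\<close> is what the rounding in the first moment bound
      requires.\<close>
    have "\<forall>\<^sub>F n in sequentially. d \<le> real n" "\<forall>\<^sub>F n in sequentially. 1 \<le> \<alpha> * (ln d / d) * real n"
      using rate by real_asymp+
    with eventually_poly_exp_le[OF \<eta>, of "(2 + \<alpha>) * ln d"]
    have "\<forall>\<^sub>F n in sequentially.
      (let k = \<alpha> * (ln d / d) * real n in
        measure_pmf.prob
          (pair_pmf (erdos_renyi n (d / real n)) (erdos_renyi n (d / real n)))
          {(Y, Y').
             overlap_gap_property (cube n) (overlap n) (path_family n (e n) Y Y')
               k (\<nu>\<^sub>1 * (k / real n)) (\<nu>\<^sub>2 * (k / real n)) \<and>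
             separated_above (cube n) (overlap n) (\<nu>\<^sub>1 * (k / real n)) k
               (objective n (e n) Y) (objective n (e n) Y')}
        \<ge> 1 - exp (- (\<eta> / 2) * real n))"
    proof eventually_elim
      case (elim n)
      have "1 < d" "6 \<le> \<delta> * (ln d)\<^sup>2" "\<alpha> * (ln d / d) \<le> 1"
        using d by auto
      from prob_overlap_gap_ge[OF assms(1) \<alpha> \<nu> gap this elim(2) refl elim(3)] elim(1)
      show ?case
        unfolding Let_def \<eta>_def by linarith
    qed
    then show ?thesis
      using \<eta> by (intro exI[of _ "\<eta> / 2"]) auto
  qed
  then show ?thesis
    \<comment> \<open>The maximum with 1 makes the threshold for \<open>d\<close> positive.\<close>
    using \<nu> d\<^sub>0[of "max d\<^sub>0 1"] by (intro exI[of _ \<nu>\<^sub>1] exI[of _ \<nu>\<^sub>2] exI[of _ "max d\<^sub>0 1"]) auto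
qed

end
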